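(* Let $n \geq 1$ and let $K$ be a field in which every polynomial of degree $n$ (with coefficients in $K$) has a root. The linear maps $M_n(K) \to M_n(K)$ preserving the $\mathcal{L}$ relation are precisely those of the form $A \mapsto PAX$, where $P \in GL_n(K)$ and $X \in M_n(K)$.
   Context: $M_n(K)$ is the set of $n \times n$ matrices over $K$, viewed as a $K$-vector space and as a monoid under multiplication; $GL_n(K)$ is its group of invertible matrices. Green's relation $\mathcal{L}$ on $M_n(K)$: $A\,\mathcal{L}\,B$ if there exist $X, Y \in M_n(K)$ with $A = XB$ and $B = YA$. A map $T$ preserves $\mathcal{L}$ if $A\,\mathcal{L}\,B$ implies $T(A)\,\mathcal{L}\,T(B)$ for all $A, B \in M_n(K)$. *)

theory Defs
  imports "HOL-Analysis.Analysis" "HOL-Computational_Algebra.Polynomial"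
begin

(* The library's vector scaling on a type of matrices would take row vectors as scalars,
   so scaling a matrix by a field element is introduced separately. *)
definition mat_scale :: "'k::field \<Rightarrow> 'k^'n^'m \<Rightarrow> 'k^'n^'m" (infixr \<open>*\<^sub>m\<close> 75)
  where "c *\<^sub>m A = (\<chi> i j. c * A $ i $ j)"

lemma vector_space_mat_scale: "vector_space (mat_scale :: 'k::field \<Rightarrow> 'k^'n^'m \<Rightarrow> 'k^'n^'m)"
  by unfold_locales (simp_all add: mat_scale_def vec_eq_iff algebra_simps)

definition green_L :: "'k::field^'n^'n \<Rightarrow> 'k^'n^'n \<Rightarrow> bool"
  where "green_L A B \<longleftrightarrow> (\<exists>X Y. A = X ** B \<and> B = Y ** A)"

definition preserves_L :: "('k::field^'n^'n \<Rightarrow> 'k^'n^'n) \<Rightarrow> bool"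
  where "preserves_L T \<longleftrightarrow> (\<forall>A B. green_L A B \<longrightarrow> green_L (T A) (T B))"

end

(* Fix a vector v. Since GL_n spans M_n, preservation of L makes {A. T A v = 0} a left ideal, and
   it is the kernel of a linear map into K^n; a dimension count then forces T A v = P_v A w_v with
   P_v invertible. As T A v is linear in v, the tensors P_v \<otimes> w_v form a linear space of rank
   one tensors, so either the P_v are all proportional, or the w_v are. In the second case T A v =
   Q_v A w with Q_v linear in v and every Q_v zero or invertible; since det (Q + c P) has degree n
   in c, it has a root, so such a space of matrices is at most a line and again the P_v are
   proportional. Absorbing the scalars into w_v, which is then linear in v, gives X. *)

theory Submission
  imports Defs
begin

section \<open>Rank-one matrices and matrix units\<close>

text \<open>The rank-one tensor x \<otimes> a, a column times a row.\<close>

definition outer :: "'k::field^'m \<Rightarrow> 'k^'n \<Rightarrow> 'k^'n^'m"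
  where "outer x a = (\<chi> i j. x $ i * a $ j)"

definition dotp :: "'k::field^'n \<Rightarrow> 'k^'n \<Rightarrow> 'k"
  where "dotp a x = (\<Sum>j\<in>UNIV. a $ j * x $ j)"

lemma outer_mult_vector: "outer x a *v y = dotp a y *s x"
  by (simp add: outer_def dotp_def matrix_vector_mult_def vec_eq_iff sum_distrib_left mult_ac)

lemma matrix_mult_outer: "B ** outer x a = outer (B *v x) a"
  by (simp add: outer_def matrix_matrix_mult_def matrix_vector_mult_def vec_eq_iff
      sum_distrib_left mult_ac)

lemma outer_add_left: "outer (x + y) a = outer x a + outer y a"
  by (simp add: outer_def vec_eq_iff algebra_simps)

lemma outer_scale_left: "outer (c *s x) a = c *\<^sub>m outer x a"
  by (simp add: outer_def mat_scale_def vec_eq_iff algebra_simps)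

lemma outer_zero_left [simp]: "outer 0 a = 0"
  by (simp add: outer_def vec_eq_iff)

lemma dotp_diff_left: "dotp (a - b) x = dotp a x - dotp b x"
  by (simp add: dotp_def left_diff_distrib sum_subtractf)

lemma dotp_axis_left [simp]: "dotp (axis i c) x = c * x $ i"
  by (simp add: dotp_def axis_def if_distrib if_distribR sum.If_cases cong: if_cong)

lemma ex_matrix_mult_vector:
  fixes x :: "'k::field^'n" and y :: "'k^'m"
  assumes "x \<noteq> 0"
  obtains B where "B *v x = y"
proof -
  obtain i where "x $ i \<noteq> 0" using assms unfolding vec_eq_iff by auto
  then have "outer y (axis i (1 / x $ i)) *v x = y"
    by (simp add: outer_mult_vector)
  then show ?thesis by (rule that)
qed

lemma matrix_vector_mult_axis:
  fixes A :: "'k::field^'n^'m"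
  shows "A *v axis k 1 = column k A"
  by (simp add: vec_eq_iff matrix_vector_mult_def column_def axis_def
      if_distrib if_distribR sum.If_cases cong: if_cong)

lemma matrix_add_rdistrib: "(A + B) ** (C :: 'k::field^'p^'n) = A ** C + B ** C"
  by (simp add: matrix_matrix_mult_def vec_eq_iff sum.distrib distrib_right)

lemma sum_outer_columns:
  fixes A :: "'k::field^'n^'m"
  shows "(\<Sum>k\<in>UNIV. outer (A *v axis k 1) (axis k 1)) = A"
  unfolding matrix_vector_mult_axis
  by (simp add: vec_eq_iff outer_def column_def axis_def if_distrib[of "\<lambda>x. _ * x"] cong: if_cong)

lemma sum_matrix_units:
  fixes A :: "'k::field^'n^'m"
  shows "(\<Sum>i\<in>UNIV. \<Sum>k\<in>UNIV. A $ i $ k *\<^sub>m outer (axis i 1) (axis k 1)) = A"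
proof -
  have "(\<Sum>i\<in>UNIV. A $ i $ k *\<^sub>m outer (axis i 1) b) = outer (column k A) b" for k and b :: "'k^'n"
    by (simp add: vec_eq_iff outer_def column_def mat_scale_def axis_def
        if_distrib[of "\<lambda>x. x * _"] if_distrib[of "\<lambda>x. _ * x"] cong: if_cong)
  then show ?thesis
    by (subst sum.swap) (simp add: sum_outer_columns flip: matrix_vector_mult_axis)
qed

lemma mat_scale_matrix_mult: "(c *\<^sub>m A) ** B = c *\<^sub>m (A ** B)"
  by (simp add: mat_scale_def matrix_matrix_mult_def vec_eq_iff sum_distrib_left mult_ac)

lemma matrix_mult_mat_scale: "A ** (c *\<^sub>m B) = c *\<^sub>m (A ** B)"
  by (simp add: mat_scale_def matrix_matrix_mult_def vec_eq_iff sum_distrib_left mult_ac)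

lemma mat_scale_mult_vector: "(c *\<^sub>m A) *v x = c *s (A *v x)"
  by (simp add: mat_scale_def matrix_vector_mult_def vec_eq_iff sum_distrib_left mult_ac)

lemma sum_matrix_mult: "sum f S ** B = (\<Sum>i\<in>S. f i ** (B :: 'k::field^'p^'n))"
proof -
  have "0 ** B = 0"
    by (simp add: matrix_matrix_mult_def vec_eq_iff)
  then show ?thesis
    by (induction S rule: infinite_finite_induct) (auto simp: matrix_add_rdistrib)
qed

lemma invertible_inj_0:
  fixes P :: "'k::field^'n^'n"
  shows "invertible P \<longleftrightarrow> (\<forall>x. P *v x = 0 \<longrightarrow> x = 0)"
  by (metis invertible_left_inverse matrix_left_invertible_ker)

lemma invertible_surj:
  fixes P :: "'k::field^'n^'n"
  assumes "invertible P"
  obtains x where "P *v x = y"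
  using assms by (metis invertible_right_inverse matrix_vector_mul_assoc matrix_vector_mul_lid)

section \<open>Singular members of a matrix pencil\<close>

text \<open>Meant for the Leibniz terms of a determinant whose entries are linear
  polynomials.\<close>

lemma degree_coeff_prod_linear_factors:
  assumes "finite S" "\<And>i. i \<in> S \<Longrightarrow> degree (f i) \<le> 1"
  shows "degree (prod f S) \<le> card S \<and> coeff (prod f S) (card S) = (\<Prod>i\<in>S. coeff (f i) 1)"
  using assms
proof (induction S rule: finite_induct)
  case (insert a S)
  then have IH: "degree (prod f S) \<le> card S"
    "coeff (prod f S) (card S) = (\<Prod>i\<in>S. coeff (f i) 1)" and "degree (f a) \<le> 1"
    by auto
  have "f a = [:coeff (f a) 0, coeff (f a) 1:]"
    using \<open>degree (f a) \<le> 1\<close>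
    by (intro poly_eqI) (auto simp: coeff_pCons coeff_eq_0 split: nat.splits)
  then obtain b0 b1 where "f a = [:b0, b1:]" by blast
  then have "coeff (f a * prod f S) (1 + card S) = coeff (f a) 1 * coeff (prod f S) (card S)"
    using IH(1) by (simp add: coeff_eq_0)
  moreover have "degree (f a * prod f S) \<le> 1 + card S"
    using degree_mult_le[of "f a" "prod f S"] IH(1) \<open>degree (f a) \<le> 1\<close> by linarith
  ultimately show ?case
    using insert.hyps IH(2) by simp
qed simp

text \<open>The determinant of Q + tP is a polynomial in t with leading coefficient
  \<open>det P\<close> at t^n, so its degree is exactly n and \<open>root\<close> applies.\<close>

lemma exists_singular_in_pencil:
  fixes P Q :: "'k::field^'n^'n"
  assumes root: "\<forall>p::'k poly. degree p = CARD('n) \<longrightarrow> (\<exists>x. poly p x = 0)"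
    and P: "invertible P"
  obtains c where "\<not> invertible (Q + c *\<^sub>m P)"
proof -
  \<comment> \<open>The matrix Q + tP over the polynomial ring in t.\<close>
  define M :: "'k poly^'n^'n" where "M = (\<chi> i j. [:Q $ i $ j, P $ i $ j:])"
  have lin: "degree (M $ i $ j) \<le> 1" for i j
    by (simp add: M_def)
  have bnd: "degree (\<Prod>i\<in>UNIV. M $ i $ f i) \<le> CARD('n)"
    and cf: "coeff (\<Prod>i\<in>UNIV. M $ i $ f i) CARD('n) = (\<Prod>i\<in>UNIV. P $ i $ f i)" for f
    using degree_coeff_prod_linear_factors[of UNIV "\<lambda>i. M $ i $ f i"] lin by (simp_all add: M_def)
  have "coeff (det M) CARD('n) = det P"
    unfolding det_def by (simp add: coeff_sum cf of_int_poly)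
  then have "coeff (det M) CARD('n) \<noteq> 0"
    using P by (simp add: invertible_det_nz)
  moreover have "degree (det M) \<le> CARD('n)"
    unfolding det_def
    by (intro degree_sum_le finite_permutations finite) (simp add: of_int_poly bnd)
  ultimately have "degree (det M) = CARD('n)"
    by (simp add: le_antisym le_degree)
  then obtain c where "poly (det M) c = 0"
    using root by blast
  moreover have "poly (det M) c = det (Q + c *\<^sub>m P)"
    unfolding det_def
    by (simp add: poly_sum poly_prod of_int_poly M_def mat_scale_def)
  ultimately show thesis
    using that by (simp add: invertible_det_nz)
qed

section \<open>Left ideals as kernels of linear maps\<close>

text \<open>Every matrix unit is built from invertible matrices by sums and products, so closure
  under the group and under linear combinations gives closure under all left
  multiplications.\<close>

lemma left_ideal_if_GL_closed:
  fixes Z :: "('k::field^'n^'n) set"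
  assumes zero: "0 \<in> Z"
    and add: "\<And>A B. A \<in> Z \<Longrightarrow> B \<in> Z \<Longrightarrow> A + B \<in> Z"
    and scale: "\<And>c A. A \<in> Z \<Longrightarrow> c *\<^sub>m A \<in> Z"
    and GL: "\<And>G A. invertible G \<Longrightarrow> A \<in> Z \<Longrightarrow> G ** A \<in> Z"
    and A: "A \<in> Z"
  shows "B ** A \<in> Z"
proof -
  define E :: "'n \<Rightarrow> 'n \<Rightarrow> 'k^'n^'n" where "E i j = outer (axis i 1) (axis j 1)" for i j
  have EE: "E i j ** E k l = (if j = k then E i l else 0)" for i j k l
    by (simp add: E_def matrix_mult_outer outer_mult_vector) (simp add: axis_def)
  have off: "E i j ** C \<in> Z" if "i \<noteq> j" "C \<in> Z" for i j C
  proof -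
    \<comment> \<open>Off the diagonal \<open>E i j\<close> squares to zero, so this transvection is
      invertible over any field; then \<open>E i j ** C\<close> is the difference of its product
      with \<open>C\<close> and \<open>C\<close> itself.\<close>
    have "(mat 1 + E i j) ** (mat 1 + (- 1) *\<^sub>m E i j) = mat 1 + (E i j + (- 1) *\<^sub>m E i j)"
      using that(1)
      by (simp add: matrix_add_ldistrib matrix_add_rdistrib matrix_mult_mat_scale EE)
    also have "\<dots> = mat 1"
      by (simp add: mat_scale_def vec_eq_iff)
    finally have "(mat 1 + E i j) ** (mat 1 + (- 1) *\<^sub>m E i j) = mat 1" .
    then have "invertible (mat 1 + E i j)"
      by (metis invertible_right_inverse)
    then have "(mat 1 + E i j) ** C + (- 1) *\<^sub>m C \<in> Z"
      using that(2) by (intro add GL scale)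
    moreover have "(- 1) *\<^sub>m C = - C"
      by (simp add: mat_scale_def vec_eq_iff)
    ultimately show ?thesis
      by (simp add: matrix_add_rdistrib)
  qed
  have unit: "E i j ** C \<in> Z" if "C \<in> Z" for i j C
  proof (cases "\<exists>k. k \<noteq> i")
    case True
    then obtain k where "k \<noteq> i" by blast
    \<comment> \<open>A diagonal unit is a product of two off-diagonal ones through a second index;
      without such an index n = 1 and the unit is the identity.\<close>
    then have "E i k ** (E k i ** C) \<in> Z"
      using that by (intro off) auto
    then have "E i i ** C \<in> Z"
      by (simp add: matrix_mul_assoc EE)
    then show ?thesis
      using off that by (cases "i = j") auto
  next
    case False
    then have "E i j = mat 1"
      by (auto simp: E_def outer_def vec_eq_iff mat_def axis_def) metis+
    then show ?thesis using that by simp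
  qed
  have sums: "sum f S \<in> Z" if "\<And>i. i \<in> S \<Longrightarrow> f i \<in> Z" for f :: "'n \<Rightarrow> 'k^'n^'n" and S
    using that by (induction S rule: infinite_finite_induct) (auto intro: zero add)
  have "B ** A = (\<Sum>i\<in>UNIV. \<Sum>k\<in>UNIV. B $ i $ k *\<^sub>m (E i k ** A))"
    by (subst sum_matrix_units[of B, symmetric])
       (simp add: sum_matrix_mult mat_scale_matrix_mult E_def)
  then show ?thesis
    by (simp add: sums scale unit A)
qed

text \<open>Modulo the kernel, every \<open>outer z a\<close> is a multiple of
  \<open>outer z a0\<close> for one fixed row \<open>a0\<close>, and the ideal property makes the
  factor independent of \<open>z\<close>. So \<open>F\<close> is an invertible map of the column
  after a contraction of the row.\<close>

lemma linear_left_ideal_kernel: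
  fixes F :: "'k::field^'n^'n \<Rightarrow> 'k^'n"
  assumes lin: "Vector_Spaces.linear mat_scale (*s) F"
    and ideal: "\<And>A B. F A = 0 \<Longrightarrow> F (B ** A) = 0"
  obtains P w where "invertible P" "\<And>A. F A = P *v (A *v w)"
proof -
  have add: "F (A + B) = F A + F B" and scale: "F (c *\<^sub>m A) = c *s F A" for A B c
    using lin by (auto simp: Vector_Spaces.linear_iff)
  have sum: "F (sum f S) = (\<Sum>i\<in>S. F (f i))" for f :: "'n \<Rightarrow> 'k^'n^'n" and S
    using module_hom.sum[OF lin[unfolded linear_iff_module_hom]] .
  have expand: "F A = (\<Sum>k\<in>UNIV. F (outer (A *v axis k 1) (axis k 1)))" for A
    by (subst sum_outer_columns[of A, symmetric]) (rule sum)
  show thesis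
  proof (cases "\<forall>x a. F (outer x a) = 0")
    case True
    then have "F A = mat 1 *v (A *v 0)" for A
      using expand[of A] by simp
    then show ?thesis
      using that[of "mat 1" 0] by (simp add: invertible_inj_0)
  next
    case False
    then obtain x0 a0 where nz: "F (outer x0 a0) \<noteq> 0" by blast
    text \<open>The map \<open>x \<mapsto> F (outer x a0)\<close> is injective, hence onto; this replaces the dimension count.\<close>
    define P where "P = matrix (\<lambda>x. F (outer x a0))"
    have "Vector_Spaces.linear (*s) (*s) (\<lambda>x. F (outer x a0))"
      by (simp add: Vector_Spaces.linear_iff vec.vector_space_axioms outer_add_left outer_scale_left add scale)
    then have P: "P *v x = F (outer x a0)" for x
      by (simp add: P_def matrix_works)
    have "x = 0" if "P *v x = 0" for x
    proof (rule ccontr)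
      assume "x \<noteq> 0"
      \<comment> \<open>The ideal property would carry the zero from \<open>outer x a0\<close> to
        \<open>outer x0 a0\<close>.\<close>
      then obtain B where "B *v x = x0" using ex_matrix_mult_vector by blast
      then show False
        using ideal[of "outer x a0" B] that nz by (simp add: P matrix_mult_outer)
    qed
    then have inv: "invertible P"
      by (simp add: invertible_inj_0)
    have "\<exists>l. \<forall>z. F (outer z a) = l *s (P *v z)" for a
    proof -
      define j :: 'n where "j = undefined"
      \<comment> \<open>Surjectivity of \<open>P\<close> yields an element of the kernel,
        \<open>outer (axis j 1) a\<close> minus \<open>outer x a0\<close>, for an arbitrary index
        \<open>j\<close>. Left multiplication by \<open>outer z (axis j 1)\<close> sends its columns
        to \<open>z\<close> and \<open>x $ j *s z\<close>, so the factor is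
        \<open>x $ j\<close>.\<close>
      obtain x where x: "P *v x = F (outer (axis j 1) a)"
        using invertible_surj[OF inv] by blast
      have "F (outer (axis j 1) a + (- 1) *\<^sub>m outer x a0) = 0"
        by (simp add: add scale x[symmetric] P)
      then have "F (outer z (axis j 1) ** (outer (axis j 1) a + (- 1) *\<^sub>m outer x a0)) = 0" for z
        by (rule ideal)
      moreover have "outer z (axis j 1) ** (outer (axis j 1) a + (- 1) *\<^sub>m outer x a0)
          = outer z a + (- x $ j) *\<^sub>m outer z a0" for z
        by (simp add: matrix_add_ldistrib matrix_mult_mat_scale matrix_mult_outer outer_mult_vector)
           (simp add: outer_def mat_scale_def axis_def vec_eq_iff)
      ultimately have "F (outer z a + (- x $ j) *\<^sub>m outer z a0) = 0" for z
        by metis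
      then have "F (outer z a) = x $ j *s (P *v z)" for z
        unfolding add scale P by (simp add: vector_smult_lneg)
      then show ?thesis by blast
    qed
    then obtain l where l: "\<And>a z. F (outer z a) = l a *s (P *v z)"
      by metis
    define w where "w = (\<chi> k. l (axis k 1))"
    have "F A = P *v (A *v w)" for A
    proof -
      have "A *v w = (\<Sum>k\<in>UNIV. l (axis k 1) *s (A *v axis k 1))"
        by (subst matrix_mult_sum) (simp add: w_def matrix_vector_mult_axis)
      then show ?thesis
        by (simp add: expand[of A] l vec.linear_sum[OF matrix_vector_mul_linear_gen]
            vector_scalar_commute)
    qed
    with inv show ?thesis by (rule that)
  qed
qed

section \<open>Linear spaces of rank-one tensors\<close>

text \<open>The equation reads P1 \<otimes> w1 + P2 \<otimes> w2 = P3 \<otimes> w3: a sum of two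
  rank-one tensors with independent second factors has rank at most one only if the first factors
  are dependent.\<close>

lemma proportional_left_factors:
  fixes P1 P2 P3 :: "'k::field^'n^'n" and w1 w2 w3 :: "'k^'n"
  assumes eq: "\<And>A. P1 *v (A *v w1) + P2 *v (A *v w2) = P3 *v (A *v w3)"
    and P1: "invertible P1" and w1: "w1 \<noteq> 0" and w2: "\<And>c. w2 \<noteq> c *s w1"
  obtains c where "\<And>x. P2 *v x = c *s (P1 *v x)"
proof -
  text \<open>Contracting the second tensor factor with \<open>\<phi>\<close> kills the right-hand side.\<close>
  have "\<exists>\<phi>. dotp \<phi> w3 = 0 \<and> \<not> (dotp \<phi> w1 = 0 \<and> dotp \<phi> w2 = 0)"
  proof (cases "w3 = 0")
    case True
    obtain i where "w1 $ i \<noteq> 0" using w1 unfolding vec_eq_iff by auto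
    then show ?thesis
      using True by (intro exI[of _ "axis i 1"]) simp
  next
    case False
    then obtain i where i: "w3 $ i \<noteq> 0" unfolding vec_eq_iff by auto
    \<comment> \<open>These functionals are the 2 by 2 minors against \<open>w3\<close>; their
      common zeros are exactly the multiples of \<open>w3\<close>. If all of them killed
      \<open>w1\<close> and \<open>w2\<close>, both would lie on that line.\<close>
    define \<phi> :: "'n \<Rightarrow> 'k^'n" where "\<phi> j = axis j (w3 $ i) - axis i (w3 $ j)" for j
    have \<phi>: "dotp (\<phi> j) y = w3 $ i * y $ j - w3 $ j * y $ i" for j y
      by (simp add: \<phi>_def dotp_diff_left)
    show ?thesis
    proof (rule ccontr)
      assume neg: "\<not> ?thesis"
      have "dotp (\<phi> j) w3 = 0" for j
        by (simp add: \<phi>)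
      then have "dotp (\<phi> j) w1 = 0" "dotp (\<phi> j) w2 = 0" for j
        using neg by blast+
      then have e: "w1 = (w1 $ i / w3 $ i) *s w3" "w2 = (w2 $ i / w3 $ i) *s w3"
        using i by (simp_all add: \<phi> vec_eq_iff field_simps)
      then have "w1 $ i \<noteq> 0" using w1 by auto
      then have "w2 = (w2 $ i / w1 $ i) *s w1"
        by (subst e(2), subst (2) e(1)) (use i in \<open>simp add: vector_smult_assoc\<close>)
      then show False using w2 by blast
    qed
  qed
  then obtain \<phi> where \<phi>: "dotp \<phi> w3 = 0" "dotp \<phi> w1 \<noteq> 0 \<or> dotp \<phi> w2 \<noteq> 0" by blast
  have eq': "dotp \<phi> w1 *s (P1 *v x) + dotp \<phi> w2 *s (P2 *v x) = 0" for x
    using eq[of "outer x \<phi>"] by (simp add: outer_mult_vector vector_scalar_commute \<phi>(1))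
  have "dotp \<phi> w2 \<noteq> 0"
  proof
    assume "dotp \<phi> w2 = 0"
    then have "P1 *v w1 = 0" using eq'[of w1] \<phi>(2) by simp
    then show False using P1 w1 by (simp add: invertible_inj_0)
  qed
  then have "P2 *v x = (- dotp \<phi> w1 / dotp \<phi> w2) *s (P1 *v x)" for x
    using eq'[of x] by (simp add: vec_eq_iff field_simps eq_neg_iff_add_eq_0 add.commute)
  then show ?thesis by (rule that)
qed

lemma common_left_factor:
  fixes T :: "'k::field^'n^'n \<Rightarrow> 'k^'n^'n"
  assumes root: "\<forall>p::'k poly. degree p = CARD('n) \<longrightarrow> (\<exists>x. poly p x = 0)"
    and rank1: "\<And>v. \<exists>P w. invertible P \<and> (\<forall>A. T A *v v = P *v (A *v w))"
  obtains P where "invertible P" "\<And>v. \<exists>w. \<forall>A. T A *v v = P *v (A *v w)"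
proof -
  \<comment> \<open>These choices need not depend linearly on \<open>v\<close>; only
    \<open>T A *v v\<close> does.\<close>
  obtain P w where P: "\<And>v. invertible (P v)" and T: "\<And>v A. T A *v v = P v *v (A *v w v)"
    using rank1 by metis
  have ratio: "\<exists>c. \<forall>x. P v *v x = c *s (P u *v x)"
    if "w u \<noteq> 0" "\<And>c. w v \<noteq> c *s w u" for u v
    using proportional_left_factors[of "P u" "w u" "P v" "w v" "P (u + v)" "w (u + v)"] P that
    by (metis T matrix_vector_right_distrib)
  \<comment> \<open>The span of all \<open>w v\<close> has dimension 0, at least 2, or exactly
    1.\<close>
  consider (zero) "\<forall>v. w v = 0"
    | (indep) u v where "w u \<noteq> 0" "\<forall>c. w v \<noteq> c *s w u"
    | (dep) u where "w u \<noteq> 0" "\<forall>v. \<exists>c. w v = c *s w u"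
    by metis
  then show thesis
  proof cases
    case zero
    then have "T A *v v = P 0 *v (A *v 0)" for A v
      by (simp add: T)
    then show ?thesis using that[of "P 0"] P by blast
  next
    case indep
    obtain e where e: "\<And>x. P v *v x = e *s (P u *v x)"
      using ratio[of u v] indep by blast
    have "\<exists>w'. \<forall>A. T A *v z = P u *v (A *v w')" for z
    proof -
      have "\<exists>c. \<forall>x. P z *v x = c *s (P u *v x)" if "w z \<noteq> 0"
      proof (cases "\<exists>c. w z = c *s w u")
        case True
        then obtain c where c: "w z = c *s w u" by blast
        \<comment> \<open>The pair u, z is dependent here, so \<open>P z\<close> is compared with
          \<open>P u\<close> through \<open>P v\<close>.\<close>
        have "w v \<noteq> d *s w z" for d
          using indep(2) by (simp add: c vector_smult_assoc)
        then obtain d where d: "\<And>x. P v *v x = d *s (P z *v x)"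
          using ratio[of z v] \<open>w z \<noteq> 0\<close> by blast
        have "P v *v w u \<noteq> 0"
          using P[of v] indep(1) by (auto simp: invertible_inj_0)
        then have "d \<noteq> 0" using d[of "w u"] by auto
        have "P z *v x = (e / d) *s (P u *v x)" for x
          using d[of x] e[of x] \<open>d \<noteq> 0\<close> by (simp add: vec_eq_iff field_simps)
        then show ?thesis by blast
      next
        case False
        then show ?thesis using ratio[of u z] indep(1) by blast
      qed
      then obtain c where "w z = 0 \<or> (\<forall>x. P z *v x = c *s (P u *v x))" by blast
      then have "T A *v z = P u *v (A *v (c *s w z))" for A
        by (auto simp: T vector_scalar_commute)
      then show ?thesis by blast
    qed
    with P[of u] show ?thesis by (rule that)
  next
    case dep
    have "\<exists>w'. \<forall>A. T A *v v = P u *v (A *v w')" for v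
    proof -
      obtain c where c: "w v = c *s w u" using dep(2) by blast
      \<comment> \<open>The singular matrix is the one through which \<open>T A\<close> acts at
        \<open>v + d *s u\<close>. There the first factor is again invertible, so the second must
        vanish, which leaves \<open>T A *v v\<close> equal to \<open>- d\<close> times
        \<open>T A *v u\<close>.\<close>
      obtain d where "\<not> invertible (c *\<^sub>m P v + d *\<^sub>m P u)"
        using exists_singular_in_pencil[OF root P] .
      then obtain x where x: "x \<noteq> 0" "(c *\<^sub>m P v + d *\<^sub>m P u) *v x = 0"
        by (auto simp: invertible_inj_0)
      have pencil: "T A *v (v + d *s u) = (c *\<^sub>m P v + d *\<^sub>m P u) *v (A *v w u)" for A
        by (simp add: matrix_vector_right_distrib matrix_vector_mult_add_rdistrib
            vector_scalar_commute mat_scale_mult_vector T c)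
      obtain f where f: "w (v + d *s u) = f *s w u" using dep(2) by blast
      \<comment> \<open>Taking \<open>A *v w u\<close> to be the kernel vector isolates the scalar
        \<open>f\<close>.\<close>
      obtain A where "A *v w u = x" using ex_matrix_mult_vector[OF dep(1)] .
      then have "P (v + d *s u) *v (f *s x) = 0"
        using pencil[of A] x(2) T[of A "v + d *s u"] by (simp add: f vector_scalar_commute)
      then have "f *s x = 0"
        using P[of "v + d *s u"] unfolding invertible_inj_0 by blast
      then have "f = 0"
        using x(1) by simp
      then have "T A *v (v + d *s u) = 0" for A
        by (simp add: T f)
      then have "T A *v v + d *s (P u *v (A *v w u)) = 0" for A
        by (simp add: matrix_vector_right_distrib vector_scalar_commute T)
      then have "T A *v v = (- d) *s (P u *v (A *v w u))" for A
        by (simp only: vector_smult_lneg eq_neg_iff_add_eq_0)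
      then have "T A *v v = P u *v (A *v ((- d) *s w u))" for A
        by (simp only: vector_scalar_commute)
      then show ?thesis by blast
    qed
    with P[of u] show ?thesis by (rule that)
  qed
qed

section \<open>The two directions of the classification\<close>

lemma linear_preserves_L_imp:
  fixes T :: "'k::field^'n^'n \<Rightarrow> 'k^'n^'n"
  assumes root: "\<forall>p::'k poly. degree p = CARD('n) \<longrightarrow> (\<exists>x. poly p x = 0)"
    and lin: "Vector_Spaces.linear mat_scale mat_scale T"
    and pres: "preserves_L T"
  obtains P X where "invertible P" "T = (\<lambda>A. P ** A ** X)"
proof -
  have add: "T (A + B) = T A + T B" and scale: "T (c *\<^sub>m A) = c *\<^sub>m T A" for A B c
    using lin by (auto simp: Vector_Spaces.linear_iff)
  have "T 0 = 0" using add[of 0 0] by simp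
  have GL: "T (G ** A) *v v = 0" if "invertible G" "T A *v v = 0" for G A v
  proof -
    \<comment> \<open>An invertible \<open>G\<close> stays inside the L-class, so
      \<open>T (G ** A)\<close> is a left multiple of \<open>T A\<close> and vanishes wherever
      \<open>T A\<close> does.\<close>
    have "green_L A (G ** A)"
      using that(1) unfolding green_L_def invertible_left_inverse
      by (metis matrix_mul_assoc matrix_mul_lid)
    then obtain Y where "T (G ** A) = Y ** T A"
      using pres by (auto simp: preserves_L_def green_L_def)
    then show ?thesis
      using that(2) by (simp flip: matrix_vector_mul_assoc)
  qed
  have "\<exists>P w. invertible P \<and> (\<forall>A. T A *v v = P *v (A *v w))" for v
  proof -
    have "Vector_Spaces.linear mat_scale (*s) (\<lambda>A. T A *v v)"
      by (simp add: Vector_Spaces.linear_iff vec.vector_space_axioms vector_space_mat_scale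
          add scale matrix_vector_mult_add_rdistrib mat_scale_mult_vector)
    moreover have "T (B ** A) *v v = 0" if "T A *v v = 0" for A B
      using left_ideal_if_GL_closed[of "{A. T A *v v = 0}" A B] that \<open>T 0 = 0\<close> GL
      by (simp add: add scale matrix_vector_mult_add_rdistrib mat_scale_mult_vector)
    ultimately show ?thesis
      using linear_left_ideal_kernel[of "\<lambda>A. T A *v v"] by metis
  qed
  from common_left_factor[OF root this] obtain P
    where P: "invertible P" and "\<And>v. \<exists>w. \<forall>A. T A *v v = P *v (A *v w)" by blast
  then obtain w where w: "\<And>v A. T A *v v = P *v (A *v w v)" by metis
  \<comment> \<open>Column j of \<open>X\<close> is the vector belonging to the j-th basis vector,
    so both sides agree column by column.\<close>
  define X where "X = (\<chi> i j. w (axis j 1) $ i)"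
  have "column j (T A) = column j (P ** A ** X)" for j A
    using w[of A "axis j 1"]
    by (simp flip: matrix_vector_mult_axis matrix_vector_mul_assoc)
       (simp add: matrix_vector_mult_axis column_def X_def)
  then have "T A = P ** A ** X" for A
    by (simp add: vec_eq_iff column_def)
  with P show ?thesis using that by blast
qed

lemma preserves_L_mult:
  fixes P X :: "'k::field^'n^'n"
  assumes "invertible P"
  shows "preserves_L (\<lambda>A. P ** A ** X)"
proof -
  obtain Q where Q: "Q ** P = mat 1"
    using assms by (auto simp: invertible_def)
  \<comment> \<open>A left multiplier \<open>Y\<close> is transported to its conjugate by
    \<open>P\<close>; the right factor \<open>X\<close> is untouched.\<close>
  have "P ** (Y ** B) ** X = (P ** Y ** Q) ** (P ** B ** X)" for Y B
    by (metis Q matrix_mul_assoc matrix_mul_rid)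
  then show ?thesis
    unfolding preserves_L_def green_L_def by metis
qed

theorem theorem3p16:
  fixes T :: "'k::field^'n^'n \<Rightarrow> 'k^'n^'n"
  assumes "\<forall>p::'k poly. degree p = CARD('n) \<longrightarrow> (\<exists>x. poly p x = 0)"
  shows "Vector_Spaces.linear mat_scale mat_scale T \<and> preserves_L T \<longleftrightarrow>
    (\<exists>P X :: 'k^'n^'n. invertible P \<and> T = (\<lambda>A. P ** A ** X))"
proof
  assume "Vector_Spaces.linear mat_scale mat_scale T \<and> preserves_L T"
  then show "\<exists>P X :: 'k^'n^'n. invertible P \<and> T = (\<lambda>A. P ** A ** X)"
    using linear_preserves_L_imp[OF assms] by metis
next
  assume "\<exists>P X :: 'k^'n^'n. invertible P \<and> T = (\<lambda>A. P ** A ** X)"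
  then obtain P X :: "'k^'n^'n" where "invertible P" and T: "T = (\<lambda>A. P ** A ** X)" by blast
  then have "preserves_L T" by (simp add: preserves_L_mult)
  moreover have "Vector_Spaces.linear mat_scale mat_scale T"
    by (simp add: T Vector_Spaces.linear_iff vector_space_mat_scale matrix_add_ldistrib
        matrix_add_rdistrib matrix_mult_mat_scale mat_scale_matrix_mult)
  ultimately show "Vector_Spaces.linear mat_scale mat_scale T \<and> preserves_L T" by blast
qed

end
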